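(* Let $k\ge 2$ and let $\mathcal{B} = (b_{i_1\cdots i_k})$ be a $k$th order $n$-dimensional real symmetric tensor. If $$b_{i\cdots i} + \sum \{ b_{ii_2\cdots i_k} : b_{ii_2\cdots i_k} < 0,\ (i, i_2, \dots, i_k) \ne (i, \dots, i) \} \ge 0$$ for $i = 1, \dots, n$, then $\mathcal{B}$ is copositive. If $$b_{i\cdots i} + \sum \{ b_{ii_2\cdots i_k} : b_{ii_2\cdots i_k} < 0,\ (i, i_2, \dots, i_k) \ne (i, \dots, i) \} > 0$$ for $i = 1, \dots, n$, then $\mathcal{B}$ is strictly copositive.
   Context: A real $k$th order $n$-dimensional tensor is an array $\mathcal{B}=(b_{i_1\cdots i_k})$ of real numbers, $i_1,\dots,i_k\in\{1,\dots,n\}$; it is symmetric if its entries are invariant under every permutation of the indices. For a vector $x$, $\mathcal{B}x^k = \sum_{i_1,\dots,i_k=1}^n b_{i_1\cdots i_k}x_{i_1}\cdots x_{i_k}$. $\mathbb{R}^n_+$ is the set of vectors in $\mathbb{R}^n$ with all components nonnegative. A real symmetric tensor $\mathcal{B}$ is copositive if $\mathcal{B}x^k\ge 0$ for all $x\in\mathbb{R}^n_+$, and strictly copositive if $\mathcal{B}x^k>0$ for all $x\in\mathbb{R}^n_+$, $x\ne 0$. In the displayed conditions the sum runs, for the fixed $i$, over all index tuples $(i_2,\dots,i_k)\in\{1,\dots,n\}^{k-1}$ (counted with multiplicity, i.e. one term for each tuple) satisfying the stated conditions. *)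

theory Defs
  imports "HOL-Analysis.Analysis" "HOL-Combinatorics.Permutations"
begin

(* The entry b_{i_1...i_k} of a k-th order tensor is B [i_1, ..., i_k], with n = CARD('n).
   The order k is passed explicitly to every notion below; the values of B on lists of
   length other than k are never used. *)

type_synonym 'n tensor = "'n list \<Rightarrow> real"

definition index_tuples :: "nat \<Rightarrow> 'n list set" where
  "index_tuples k = {js. length js = k}"

definition symmetric_tensor :: "nat \<Rightarrow> 'n tensor \<Rightarrow> bool" where
  "symmetric_tensor k B \<longleftrightarrow>
     (\<forall>js \<in> index_tuples k. \<forall>p. p permutes {..<k} \<longrightarrow> B (permute_list p js) = B js)"

definition tensor_form :: "nat \<Rightarrow> 'n::finite tensor \<Rightarrow> real ^ 'n \<Rightarrow> real" where
  "tensor_form k B x = (\<Sum>js \<in> index_tuples k. B js * (\<Prod>l<k. x $ (js ! l)))"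

definition nonneg_orthant :: "(real ^ 'n::finite) set" where
  "nonneg_orthant = {x. \<forall>i. 0 \<le> x $ i}"

definition copositive :: "nat \<Rightarrow> 'n::finite tensor \<Rightarrow> bool" where
  "copositive k B \<longleftrightarrow>
     symmetric_tensor k B \<and> (\<forall>x \<in> nonneg_orthant. 0 \<le> tensor_form k B x)"

definition strictly_copositive :: "nat \<Rightarrow> 'n::finite tensor \<Rightarrow> bool" where
  "strictly_copositive k B \<longleftrightarrow>
     symmetric_tensor k B \<and> (\<forall>x \<in> nonneg_orthant. x \<noteq> 0 \<longrightarrow> 0 < tensor_form k B x)"

(* Sum over tuples (i_2, ..., i_k) rather than over entry values, so equal entries are
   counted with multiplicity. *)
definition neg_offdiag_sum :: "nat \<Rightarrow> 'n::finite tensor \<Rightarrow> 'n \<Rightarrow> real" where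
  "neg_offdiag_sum k B i =
     (\<Sum>js \<in> {js \<in> index_tuples (k - 1). B (i # js) < 0 \<and> i # js \<noteq> replicate k i}. B (i # js))"

lemma finite_index_tuples: "finite (index_tuples k :: 'n::finite list set)"
  using finite_lists_length_eq[of "UNIV :: 'n set" k] by (simp add: index_tuples_def)

end

theory Submission imports Defs begin

text \<open>
  On the nonnegative orthant, discarding the positive off-diagonal entries only decreases the
  form. For the negative ones, AM-GM bounds \<open>x\<^bsub>i\<^sub>1\<^esub> \<cdots> x\<^bsub>i\<^sub>k\<^esub>\<close> by the mean of the powers \<open>x\<^bsub>i\<^sub>l\<^esub>^k\<close>,
  and by symmetry each slot \<open>l\<close> contributes the same amount as the first one. Hence the form is
  at least the sum over \<open>i\<close> of \<open>x\<^bsub>i\<^esub>^k\<close> times the left-hand side of the hypothesis.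
\<close>

lemma prod_le_mean_power:
  fixes y :: "nat \<Rightarrow> real"
  assumes "k > 0" "\<And>l. l < k \<Longrightarrow> 0 \<le> y l"
  shows "(\<Prod>l<k. y l) \<le> (\<Sum>l<k. y l ^ k) / k"
proof -
  have nonneg: "0 \<le> (\<Prod>l<k. y l)"
    using assms(2) by (intro prod_nonneg) auto
  \<comment> \<open>The case \<open>z = 0\<close> is split off because \<open>powr\<close> agrees
    with \<open>^\<close> only for a positive base.\<close>
  have "(z ^ k) powr (1 / k) = z" if "0 \<le> z" for z :: real
    using assms(1) that by (cases "z = 0") (auto simp: powr_powr simp flip: powr_realpow)
  from this[OF nonneg] have "(\<Prod>l<k. y l) = (\<Prod>l<k. y l ^ k) powr (1 / k)"
    by (simp add: prod_power_distrib)
  also have "\<dots> \<le> (\<Sum>l<k. y l ^ k / k)"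
    using arith_geom_mean[of "{..<k}" "\<lambda>l. y l ^ k"] assms by auto
  finally show ?thesis
    by (simp add: sum_divide_distrib)
qed

text \<open>Being constant depends only on the set of entries, which a permutation
  preserves.\<close>

lemma constant_permute_list_iff:
  assumes "p permutes {..<length js}"
  shows "(\<exists>i. permute_list p js = replicate (length js) i) \<longleftrightarrow> (\<exists>i. js = replicate (length js) i)"
proof -
  have "xs = replicate (length js) i \<longleftrightarrow> (\<forall>y\<in>set xs. y = i)"
    if "length xs = length js" for xs :: "'a list" and i
    using that by (metis in_set_replicate replicate_eqI)
  then show ?thesis
    using assms by simp
qed

text \<open>Padding with zeros and excluding all constant tuples, rather than the one attached to a
  fixed first index, keeps this a symmetric tensor.\<close>

definition neg_offdiag :: "nat \<Rightarrow> 'n tensor \<Rightarrow> 'n tensor" where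
  "neg_offdiag k B js = (if B js < 0 \<and> (\<forall>i. js \<noteq> replicate k i) then B js else 0)"

lemma symmetric_neg_offdiag:
  assumes "symmetric_tensor k B"
  shows "symmetric_tensor k (neg_offdiag k B)"
  unfolding symmetric_tensor_def
proof (intro ballI allI impI)
  fix js :: "'a list" and p
  assume js: "js \<in> index_tuples k" and p: "p permutes {..<k}"
  have "(\<exists>i. permute_list p js = replicate k i) \<longleftrightarrow> (\<exists>i. js = replicate k i)"
    using constant_permute_list_iff[of p js] js p by (simp add: index_tuples_def)
  moreover have "B (permute_list p js) = B js"
    using assms js p by (simp add: symmetric_tensor_def)
  ultimately show "neg_offdiag k B (permute_list p js) = neg_offdiag k B js"
    unfolding neg_offdiag_def by auto
qed

text \<open>Swapping slots \<open>l\<close> and \<open>0\<close> is an involution on the tuples that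
  leaves the entries of \<open>C\<close> unchanged, so it reindexes one sum into the other.\<close>

lemma sum_symmetric_slot:
  fixes C :: "'n::finite tensor" and f :: "'n \<Rightarrow> real"
  assumes "symmetric_tensor k C" "l < k"
  shows "(\<Sum>js\<in>index_tuples k. C js * f (js ! l)) = (\<Sum>js\<in>index_tuples k. C js * f (js ! 0))"
proof -
  define p where "p = Transposition.transpose l (0::nat)"
  have p: "p permutes {..<k}"
    using assms(2) by (auto simp: p_def intro: permutes_swap_id)
  have inv: "permute_list p (permute_list p js) = js" if "js \<in> index_tuples k" for js :: "'n list"
    using that p permute_list_compose[of p js p] by (simp add: p_def index_tuples_def)
  have "permute_list p js ! 0 = js ! l" if "js \<in> index_tuples k" for js :: "'n list"
    using that p assms(2) by (subst permute_list_nth) (auto simp: p_def index_tuples_def)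
  then show ?thesis
    using assms(1) p inv
    by (intro sum.reindex_bij_witness[of _ "permute_list p" "permute_list p"])
       (auto simp: symmetric_tensor_def index_tuples_def)
qed

text \<open>A constant tuple of positive length that starts with \<open>i\<close> can only be
  \<open>replicate k i\<close>, so both notions of off-diagonal agree; the additional summands are
  zero.\<close>

lemma neg_offdiag_sum_eq:
  fixes B :: "'n::finite tensor"
  assumes "k > 0"
  shows "neg_offdiag_sum k B i = (\<Sum>js\<in>index_tuples (k - 1). neg_offdiag k B (i # js))"
proof -
  have "(\<forall>m. i # js \<noteq> replicate k m) \<longleftrightarrow> i # js \<noteq> replicate k i" for js :: "'n list"
    using assms by (cases k) auto
  then show ?thesis
    unfolding neg_offdiag_sum_def neg_offdiag_def
    by (intro sum.mono_neutral_cong_left) (auto simp: finite_index_tuples)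
qed

lemma sum_index_tuples_Cons:
  fixes g :: "'n::finite list \<Rightarrow> real"
  assumes "k > 0"
  shows "(\<Sum>js\<in>index_tuples k. g js) = (\<Sum>i\<in>UNIV. \<Sum>js\<in>index_tuples (k - 1). g (i # js))"
proof -
  have "(\<Sum>js\<in>index_tuples k. g js) = (\<Sum>(i, js)\<in>UNIV \<times> index_tuples (k - 1). g (i # js))"
    using assms
    by (intro sum.reindex_bij_witness[of _ "\<lambda>(i, js). i # js" "\<lambda>js. (hd js, tl js)"])
       (auto simp: index_tuples_def simp flip: length_0_conv)
  then show ?thesis
    by (simp add: sum.cartesian_product)
qed

text \<open>Once slot \<open>l\<close> is moved to the front, \<open>f\<close> sees only the head
  \<open>i\<close>, and summing over the tails collects the coefficient of
  \<open>f i\<close>.\<close>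

lemma sum_neg_offdiag_slot:
  fixes B :: "'n::finite tensor"
  assumes "symmetric_tensor k B" "l < k"
  shows "(\<Sum>js\<in>index_tuples k. neg_offdiag k B js * f (js ! l)) =
         (\<Sum>i\<in>UNIV. neg_offdiag_sum k B i * f i)"
  using assms
  by (subst sum_symmetric_slot)
     (simp_all add: symmetric_neg_offdiag sum_index_tuples_Cons neg_offdiag_sum_eq sum_distrib_right)

lemma tensor_form_ge:
  fixes B :: "'n::finite tensor"
  assumes "k > 0" "symmetric_tensor k B" "x \<in> nonneg_orthant"
  shows "(\<Sum>i\<in>UNIV. (B (replicate k i) + neg_offdiag_sum k B i) * x $ i ^ k) \<le> tensor_form k B x"
proof -
  define P where "P = (\<lambda>js. \<Prod>l<k. x $ (js ! l))"
  define D :: "'n list set" where "D = range (replicate k)"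
  have P_nonneg: "0 \<le> P js" for js
    using assms(3) by (auto simp: P_def nonneg_orthant_def intro: prod_nonneg)
  \<comment> \<open>All \<open>k\<close> slots give the same sum, so it equals its average over the
    slots; this creates the mean needed for AM-GM.\<close>
  have "(\<Sum>i\<in>UNIV. neg_offdiag_sum k B i * x $ i ^ k) =
        (\<Sum>l<k. \<Sum>js\<in>index_tuples k. neg_offdiag k B js * x $ (js ! l) ^ k) / k"
    using assms(1,2) by (simp add: sum_neg_offdiag_slot[where f = "\<lambda>i. x $ i ^ k"])
  also have "\<dots> = (\<Sum>js\<in>index_tuples k. neg_offdiag k B js * ((\<Sum>l<k. x $ (js ! l) ^ k) / k))"
    by (subst sum.swap) (simp add: sum_distrib_left sum_divide_distrib)
  \<comment> \<open>The coefficients are nonpositive, so the AM-GM inequality is reversed.\<close>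
  also have "\<dots> \<le> (\<Sum>js\<in>index_tuples k. neg_offdiag k B js * P js)"
    using assms(1,3) unfolding P_def
    by (intro sum_mono mult_left_mono_neg prod_le_mean_power)
       (auto simp: neg_offdiag_def nonneg_orthant_def)
  finally have off: "(\<Sum>i\<in>UNIV. neg_offdiag_sum k B i * x $ i ^ k) \<le>
      (\<Sum>js\<in>index_tuples k. neg_offdiag k B js * P js)" .
  have "(\<Sum>i\<in>UNIV. B (replicate k i) * x $ i ^ k) = (\<Sum>js\<in>D. B js * P js)"
    using assms(1) unfolding D_def
    by (subst sum.reindex) (auto simp: P_def inj_on_def)
  also have "\<dots> = (\<Sum>js\<in>index_tuples k. if js \<in> D then B js * P js else 0)"
    using finite_index_tuples by (intro sum.mono_neutral_cong_left) (auto simp: D_def index_tuples_def)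
  finally have diag: "(\<Sum>i\<in>UNIV. B (replicate k i) * x $ i ^ k) = \<dots>" .
  \<comment> \<open>Termwise: equality holds on the diagonal \<open>D\<close> and at negative
    off-diagonal entries; any other entry is nonnegative and is replaced by 0.\<close>
  have "(\<Sum>js\<in>index_tuples k. (if js \<in> D then B js * P js else 0) + neg_offdiag k B js * P js)
      \<le> (\<Sum>js\<in>index_tuples k. B js * P js)"
    using P_nonneg by (intro sum_mono) (auto simp: neg_offdiag_def D_def)
  then show ?thesis
    using off diag by (simp add: tensor_form_def P_def sum.distrib distrib_right)
qed

theorem theorem10:
  fixes k :: nat and B :: "'n::finite tensor"
  assumes "k \<ge> 2" and "symmetric_tensor k B"
  shows "((\<forall>i. B (replicate k i) + neg_offdiag_sum k B i \<ge> 0) \<longrightarrow> copositive k B) \<and>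
         ((\<forall>i. B (replicate k i) + neg_offdiag_sum k B i > 0) \<longrightarrow> strictly_copositive k B)"
proof -
  let ?d = "\<lambda>i. B (replicate k i) + neg_offdiag_sum k B i"
  have bound: "(\<Sum>i\<in>UNIV. ?d i * x $ i ^ k) \<le> tensor_form k B x" if "x \<in> nonneg_orthant" for x
    using assms that by (intro tensor_form_ge) auto
  have "0 \<le> tensor_form k B x" if "\<forall>i. ?d i \<ge> 0" "x \<in> nonneg_orthant" for x
    using that by (intro order_trans[OF _ bound] sum_nonneg) (auto simp: nonneg_orthant_def)
  moreover have "0 < tensor_form k B x" if d: "\<forall>i. ?d i > 0" and x: "x \<in> nonneg_orthant" "x \<noteq> 0" for x
  proof -
    obtain i where i: "x $ i \<noteq> 0"
      using x(2) by (auto simp: vec_eq_iff)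
    have nn: "\<And>j. 0 \<le> x $ j"
      using x(1) by (simp add: nonneg_orthant_def)
    \<comment> \<open>A single nonzero coordinate already makes the lower bound positive.\<close>
    have "0 < ?d i * x $ i ^ k"
      using d nn[of i] i by simp
    moreover have "0 \<le> ?d j * x $ j ^ k" for j
      using d nn[of j] by (simp add: less_imp_le)
    ultimately have "0 < (\<Sum>i\<in>UNIV. ?d i * x $ i ^ k)"
      by (intro sum_pos2[of _ i]) auto
    then show ?thesis
      using bound[OF x(1)] by simp
  qed
  ultimately show ?thesis
    using assms(2) by (auto simp: copositive_def strictly_copositive_def)
qed

end
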